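(* Let $\mathcal A,\mathcal B$ be unital Banach algebras with units $1_{\mathcal A},1_{\mathcal B}$, let $\mathcal M$ be a unital Banach $\mathcal A$-$\mathcal B$-bimodule, let $\mathcal T=\mathrm{Tri}(\mathcal A,\mathcal M,\mathcal B)$, and let $\sigma,\tau:\mathcal T\to\mathcal T$ be continuous homomorphisms with $\sigma(1_{\mathcal A}\oplus 0)=\tau(1_{\mathcal A}\oplus 0)=1_{\mathcal A}\oplus 0$ and $\sigma(0\oplus 1_{\mathcal B})=\tau(0\oplus 1_{\mathcal B})=0\oplus 1_{\mathcal B}$. Then the triangular Banach algebra $\mathcal T$ is $(\sigma,\tau)$-weakly amenable if and only if $\mathcal A$ and $\mathcal B$ are both $(\sigma,\tau)$-weakly amenable.
   Context: $\mathrm{Tri}(\mathcal A,\mathcal M,\mathcal B)$ is the algebra of matrices $\begin{bmatrix}a&m\\0&b\end{bmatrix}$ ($a\in\mathcal A$, $m\in\mathcal M$, $b\in\mathcal B$) with the usual matrix addition and multiplication and the norm $\|a\|+\|m\|+\|b\|$. A unital Banach $\mathcal A$-$\mathcal B$-bimodule satisfies $a(mb)=(am)b$ and $1_{\mathcal A}m=m1_{\mathcal B}=m$. Write $a\oplus b=\begin{bmatrix}a&0\\0&b\end{bmatrix}$; identify $a\in\mathcal A$ with $a\oplus 0$ and $b\in\mathcal B$ with $0\oplus b$. The conditions on $\sigma,\tau$ imply $\sigma(\mathcal A)\subseteq\mathcal A$, $\sigma(\mathcal B)\subseteq\mathcal B$ and likewise for $\tau$; the restrictions of $\sigma,\tau$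 to $\mathcal A$ and to $\mathcal B$ are denoted again by $\sigma,\tau$. For a Banach algebra $\mathcal C$, the topological dual $\mathcal C^*$ is a Banach $\mathcal C$-bimodule via $(c\cdot f)(s)=f(sc)$, $(f\cdot c)(s)=f(cs)$. For a Banach algebra $\mathcal C$, continuous homomorphisms $\sigma,\tau:\mathcal C\to\mathcal C$ and a Banach $\mathcal C$-bimodule $\mathcal E$: a $(\sigma,\tau)$-derivation is a linear map $d:\mathcal C\to\mathcal E$ with $d(ab)=d(a)\sigma(b)+\tau(a)d(b)$ for all $a,b\in\mathcal C$; it is $(\sigma,\tau)$-inner if there is $x\in\mathcal E$ with $d(a)=\tau(a)x-x\sigma(a)$ for all $a$. $\mathcal C$ is $(\sigma,\tau)$-weakly amenable if every continuous $(\sigma,\tau)$-derivation $\mathcal C\to\mathcal C^*$ is $(\sigma,\tau)$-inner, i.e. $H^1_{(\sigma,\tau)}(\mathcal C,\mathcal C^* )=0$. *)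

theory Defs
  imports "HOL-Analysis.Analysis"
begin

section \<open>Banach spaces, algebras and bimodules over the scalar field\<close>

text \<open>
  Scalars range over an arbitrary type of class \<^class>\<open>real_normed_field\<close>; by Gelfand-Mazur such a
  field is isometrically isomorphic to the reals or to the complex numbers, so both real and complex
  Banach algebras are covered. The class \<^class>\<open>banach\<close> supplies the norm, its completeness and
  the scaling by reals; \<open>smul\<close> is the scaling by the field and extends the latter.

  Multiplications are explicit parameters, not the class operation, because the
  multiplication of a triangular algebra depends on the module actions. The norm of a unit is not
  assumed to be 1 (in a triangular algebra the unit has norm \<open>\<parallel>1\<^sub>A\<parallel> + \<parallel>1\<^sub>B\<parallel>\<close>).
\<close>

locale banach_space_over = vector_space smul
  for smul :: "'k::real_normed_field \<Rightarrow> 'v::banach \<Rightarrow> 'v" +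
  assumes scale_of_real: "smul (of_real r) x = r *\<^sub>R x"
    and norm_scale: "norm (smul c x) = norm c * norm x"

locale banach_algebra = banach_space_over smul
  for smul :: "'k::real_normed_field \<Rightarrow> 'c::banach \<Rightarrow> 'c" +
  fixes mul :: "'c \<Rightarrow> 'c \<Rightarrow> 'c"
  assumes mult_assoc: "mul (mul x y) z = mul x (mul y z)"
    and mult_add_left: "mul (x + y) z = mul x z + mul y z"
    and mult_add_right: "mul x (y + z) = mul x y + mul x z"
    and mult_scale_left: "mul (smul c x) y = smul c (mul x y)"
    and mult_scale_right: "mul x (smul c y) = smul c (mul x y)"
    and norm_mult_le: "norm (mul x y) \<le> norm x * norm y"

locale unital_banach_algebra = banach_algebra smul mul
  for smul :: "'k::real_normed_field \<Rightarrow> 'c::banach \<Rightarrow> 'c" and mul :: "'c \<Rightarrow> 'c \<Rightarrow> 'c" +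
  fixes unit :: 'c
  assumes unit_left: "mul unit x = x"
    and unit_right: "mul x unit = x"

locale unital_banach_bimodule =
  A: unital_banach_algebra scaleA multA unitA +
  B: unital_banach_algebra scaleB multB unitB +
  M: banach_space_over scaleM
  for scaleA :: "'k::real_normed_field \<Rightarrow> 'a::banach \<Rightarrow> 'a" and multA unitA
    and scaleB :: "'k \<Rightarrow> 'b::banach \<Rightarrow> 'b" and multB unitB
    and scaleM :: "'k \<Rightarrow> 'm::banach \<Rightarrow> 'm" +
  fixes lact :: "'a \<Rightarrow> 'm \<Rightarrow> 'm" and ract :: "'m \<Rightarrow> 'b \<Rightarrow> 'm"
  assumes lact_add_left: "lact (a + a') m = lact a m + lact a' m"
    and lact_add_right: "lact a (m + m') = lact a m + lact a m'"
    and lact_scale_left: "lact (scaleA c a) m = scaleM c (lact a m)"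
    and lact_scale_right: "lact a (scaleM c m) = scaleM c (lact a m)"
    and ract_add_left: "ract (m + m') b = ract m b + ract m' b"
    and ract_add_right: "ract m (b + b') = ract m b + ract m b'"
    and ract_scale_left: "ract (scaleM c m) b = scaleM c (ract m b)"
    and ract_scale_right: "ract m (scaleB c b) = scaleM c (ract m b)"
    and lact_mult: "lact (multA a a') m = lact a (lact a' m)"
    and ract_mult: "ract m (multB b b') = ract (ract m b) b'"
    and lact_ract: "lact a (ract m b) = ract (lact a m) b"
    and lact_unit: "lact unitA m = m"
    and ract_unit: "ract m unitB = m"
    and norm_lact_le: "norm (lact a m) \<le> norm a * norm m"
    and norm_ract_le: "norm (ract m b) \<le> norm m * norm b"

definition continuous_alg_hom ::
  "('k::real_normed_field \<Rightarrow> 'c::banach \<Rightarrow> 'c) \<Rightarrow> ('c \<Rightarrow> 'c \<Rightarrow> 'c) \<Rightarrow> ('c \<Rightarrow> 'c) \<Rightarrow> bool"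
  where "continuous_alg_hom smul mul \<phi> \<longleftrightarrow>
    Vector_Spaces.linear smul smul \<phi> \<and>
    (\<forall>x y. \<phi> (mul x y) = mul (\<phi> x) (\<phi> y)) \<and>
    continuous_on UNIV \<phi>"

section \<open>The dual bimodule\<close>

text \<open>
  The dual is the set of those bounded real-linear maps into the scalar field that are linear over
  that field, with the operator norm of \<^typ>\<open>'c \<Rightarrow>\<^sub>L 'k\<close>.
\<close>

definition dual :: "('k::real_normed_field \<Rightarrow> 'c::banach \<Rightarrow> 'c) \<Rightarrow> ('c \<Rightarrow>\<^sub>L 'k) set"
  where "dual smul = {f. \<forall>c s. blinfun_apply f (smul c s) = c * blinfun_apply f s}"

definition dual_scale :: "'k::real_normed_field \<Rightarrow> ('c::banach \<Rightarrow>\<^sub>L 'k) \<Rightarrow> ('c \<Rightarrow>\<^sub>L 'k)"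
  where "dual_scale c f = Blinfun (\<lambda>s. c * blinfun_apply f s)"

definition dual_lact ::
  "('c::banach \<Rightarrow> 'c \<Rightarrow> 'c) \<Rightarrow> 'c \<Rightarrow> ('c \<Rightarrow>\<^sub>L 'k::real_normed_field) \<Rightarrow> ('c \<Rightarrow>\<^sub>L 'k)"
  where "dual_lact mul c f = Blinfun (\<lambda>s. blinfun_apply f (mul s c))"

definition dual_ract ::
  "('c::banach \<Rightarrow> 'c \<Rightarrow> 'c) \<Rightarrow> ('c \<Rightarrow>\<^sub>L 'k::real_normed_field) \<Rightarrow> 'c \<Rightarrow> ('c \<Rightarrow>\<^sub>L 'k)"
  where "dual_ract mul f c = Blinfun (\<lambda>s. blinfun_apply f (mul c s))"

lemma dual_scale_apply: "blinfun_apply (dual_scale c f) s = c * blinfun_apply f s"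
  unfolding dual_scale_def
  by (subst bounded_linear_Blinfun_apply)
    (auto intro: bounded_linear_const_mult blinfun.bounded_linear_right)

lemma vector_space_dual_scale: "vector_space dual_scale"
  by unfold_locales
    (auto intro!: blinfun_eqI simp: dual_scale_apply blinfun.add_left algebra_simps)

context banach_algebra
begin

lemma bounded_bilinear_mult: "bounded_bilinear mul"
proof
  show "mul (r *\<^sub>R a) b = r *\<^sub>R mul a b" "mul a (r *\<^sub>R b) = r *\<^sub>R mul a b" for r a b
    by (metis scale_of_real mult_scale_left) (metis scale_of_real mult_scale_right)
  show "\<exists>K. \<forall>a b. norm (mul a b) \<le> norm a * norm b * K"
    using norm_mult_le by (intro exI[of _ 1]) simp
qed (fact mult_add_left mult_add_right)+

lemma dual_lact_apply:
  fixes f :: "'c \<Rightarrow>\<^sub>L 'k"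
  shows "blinfun_apply (dual_lact mul c f) s = blinfun_apply f (mul s c)"
  unfolding dual_lact_def
  by (subst bounded_linear_Blinfun_apply)
    (auto intro: bounded_linear_compose[OF blinfun.bounded_linear_right]
      bounded_bilinear.bounded_linear_left[OF bounded_bilinear_mult])

lemma dual_ract_apply:
  fixes f :: "'c \<Rightarrow>\<^sub>L 'k"
  shows "blinfun_apply (dual_ract mul f c) s = blinfun_apply f (mul c s)"
  unfolding dual_ract_def
  by (subst bounded_linear_Blinfun_apply)
    (auto intro: bounded_linear_compose[OF blinfun.bounded_linear_right]
      bounded_bilinear.bounded_linear_right[OF bounded_bilinear_mult])

lemma dual_lact_in_dual: "f \<in> dual smul \<Longrightarrow> dual_lact mul c f \<in> dual smul"
  by (simp add: dual_def dual_lact_apply mult_scale_left)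

lemma dual_ract_in_dual: "f \<in> dual smul \<Longrightarrow> dual_ract mul f c \<in> dual smul"
  by (simp add: dual_def dual_ract_apply mult_scale_right)

end

section \<open>Twisted derivations and weak amenability\<close>

text \<open>
  The bimodule of values is given by its carrier \<open>E\<close>, scaling and actions; a carrier is needed
  because the dual is a proper subset of its type when the field is not the reals.
\<close>

definition twisted_derivation ::
  "('k::real_normed_field \<Rightarrow> 'c::banach \<Rightarrow> 'c) \<Rightarrow> ('c \<Rightarrow> 'c \<Rightarrow> 'c) \<Rightarrow>
   'e::real_normed_vector set \<Rightarrow> ('k \<Rightarrow> 'e \<Rightarrow> 'e) \<Rightarrow> ('c \<Rightarrow> 'e \<Rightarrow> 'e) \<Rightarrow> ('e \<Rightarrow> 'c \<Rightarrow> 'e) \<Rightarrow>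
   ('c \<Rightarrow> 'c) \<Rightarrow> ('c \<Rightarrow> 'c) \<Rightarrow> ('c \<Rightarrow> 'e) \<Rightarrow> bool"
  where "twisted_derivation smul mul E scaleE lactE ractE \<sigma> \<tau> d \<longleftrightarrow>
    range d \<subseteq> E \<and> Vector_Spaces.linear smul scaleE d \<and>
    (\<forall>a b. d (mul a b) = ractE (d a) (\<sigma> b) + lactE (\<tau> a) (d b))"

definition twisted_inner ::
  "'e::real_normed_vector set \<Rightarrow> ('c::banach \<Rightarrow> 'e \<Rightarrow> 'e) \<Rightarrow> ('e \<Rightarrow> 'c \<Rightarrow> 'e) \<Rightarrow>
   ('c \<Rightarrow> 'c) \<Rightarrow> ('c \<Rightarrow> 'c) \<Rightarrow> ('c \<Rightarrow> 'e) \<Rightarrow> bool"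
  where "twisted_inner E lactE ractE \<sigma> \<tau> d \<longleftrightarrow>
    (\<exists>x\<in>E. \<forall>a. d a = lactE (\<tau> a) x - ractE x (\<sigma> a))"

definition weakly_amenable ::
  "('k::real_normed_field \<Rightarrow> 'c::banach \<Rightarrow> 'c) \<Rightarrow> ('c \<Rightarrow> 'c \<Rightarrow> 'c) \<Rightarrow>
   ('c \<Rightarrow> 'c) \<Rightarrow> ('c \<Rightarrow> 'c) \<Rightarrow> bool"
  where "weakly_amenable smul mul \<sigma> \<tau> \<longleftrightarrow>
    (\<forall>d :: 'c \<Rightarrow> ('c \<Rightarrow>\<^sub>L 'k).
      twisted_derivation smul mul (dual smul) dual_scale (dual_lact mul) (dual_ract mul) \<sigma> \<tau> d \<and>
      continuous_on UNIV d \<longrightarrow>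
      twisted_inner (dual smul) (dual_lact mul) (dual_ract mul) \<sigma> \<tau> d)"

section \<open>Triangular Banach algebras\<close>

text \<open>\<open>Tri a m b\<close> is the matrix with rows \<open>(a, m)\<close> and \<open>(0, b)\<close>.\<close>

datatype ('a, 'm, 'b) tri = Tri (ent11: 'a) (ent12: 'm) (ent22: 'b)

instantiation tri :: (real_normed_vector, real_normed_vector, real_normed_vector) real_normed_vector
begin

definition "(0 :: ('a, 'b, 'c) tri) = Tri 0 0 0"
definition "(x :: ('a, 'b, 'c) tri) + y = Tri (ent11 x + ent11 y) (ent12 x + ent12 y) (ent22 x + ent22 y)"
definition "(x :: ('a, 'b, 'c) tri) - y = Tri (ent11 x - ent11 y) (ent12 x - ent12 y) (ent22 x - ent22 y)"
definition "- (x :: ('a, 'b, 'c) tri) = Tri (- ent11 x) (- ent12 x) (- ent22 x)"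
definition "r *\<^sub>R (x :: ('a, 'b, 'c) tri) = Tri (r *\<^sub>R ent11 x) (r *\<^sub>R ent12 x) (r *\<^sub>R ent22 x)"
definition "norm (x :: ('a, 'b, 'c) tri) = norm (ent11 x) + norm (ent12 x) + norm (ent22 x)"
definition "sgn (x :: ('a, 'b, 'c) tri) = inverse (norm x) *\<^sub>R x"
definition "dist (x :: ('a, 'b, 'c) tri) y = norm (x - y)"
definition "(uniformity :: (('a, 'b, 'c) tri \<times> ('a, 'b, 'c) tri) filter) =
  (INF e\<in>{0<..}. principal {(x, y). dist x y < e})"
definition "open (U :: ('a, 'b, 'c) tri set) \<longleftrightarrow>
  (\<forall>x\<in>U. eventually (\<lambda>(x', y). x' = x \<longrightarrow> y \<in> U) uniformity)"

instance
proof
  fix x y :: "('a, 'b, 'c) tri"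
  have "norm (ent11 x + ent11 y) \<le> norm (ent11 x) + norm (ent11 y)"
    "norm (ent12 x + ent12 y) \<le> norm (ent12 x) + norm (ent12 y)"
    "norm (ent22 x + ent22 y) \<le> norm (ent22 x) + norm (ent22 y)"
    by (rule norm_triangle_ineq)+
  then show "norm (x + y) \<le> norm x + norm y"
    by (simp add: norm_tri_def plus_tri_def)
  show "(norm x = 0) = (x = 0)"
    by (cases x) (auto simp: norm_tri_def zero_tri_def add_nonneg_eq_0_iff)
qed (auto simp: zero_tri_def plus_tri_def minus_tri_def uminus_tri_def scaleR_tri_def norm_tri_def
    sgn_tri_def dist_tri_def uniformity_tri_def open_tri_def tri.expand algebra_simps)

end

lemma tri_sel_simps [simp]:
  "ent11 0 = 0" "ent12 0 = 0" "ent22 0 = 0"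
  "ent11 (x + y) = ent11 x + ent11 y" "ent12 (x + y) = ent12 x + ent12 y"
  "ent22 (x + y) = ent22 x + ent22 y"
  "ent11 (x - y) = ent11 x - ent11 y" "ent12 (x - y) = ent12 x - ent12 y"
  "ent22 (x - y) = ent22 x - ent22 y"
  "ent11 (- x) = - ent11 x" "ent12 (- x) = - ent12 x" "ent22 (- x) = - ent22 x"
  "ent11 (r *\<^sub>R x) = r *\<^sub>R ent11 x" "ent12 (r *\<^sub>R x) = r *\<^sub>R ent12 x"
  "ent22 (r *\<^sub>R x) = r *\<^sub>R ent22 x"
  by (simp_all add: zero_tri_def plus_tri_def minus_tri_def uminus_tri_def scaleR_tri_def)

lemma bounded_linear_ent: "bounded_linear ent11" "bounded_linear ent12" "bounded_linear ent22"
  by (auto intro!: bounded_linear_intro[where K = 1] simp: norm_tri_def)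

lemma bounded_linear_Tri:
  "bounded_linear (\<lambda>a. Tri a 0 0)" "bounded_linear (\<lambda>m. Tri 0 m 0)" "bounded_linear (\<lambda>b. Tri 0 0 b)"
  by (auto intro!: bounded_linear_intro[where K = 1] tri.expand simp: norm_tri_def)

instance tri :: (banach, banach, banach) banach
proof
  fix X :: "nat \<Rightarrow> ('a, 'b, 'c) tri"
  assume X: "Cauchy X"
  obtain a m b where lims: "(\<lambda>n. ent11 (X n)) \<longlonglongrightarrow> a" "(\<lambda>n. ent12 (X n)) \<longlonglongrightarrow> m"
    "(\<lambda>n. ent22 (X n)) \<longlonglongrightarrow> b"
    using bounded_linear_ent[THEN bounded_linear.Cauchy, OF X]
    by (meson Cauchy_convergent convergent_def)
  have "(\<lambda>n. Tri (ent11 (X n)) 0 0 + Tri 0 (ent12 (X n)) 0 + Tri 0 0 (ent22 (X n)))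
    \<longlonglongrightarrow> Tri a 0 0 + Tri 0 m 0 + Tri 0 0 b"
    by (intro tendsto_add bounded_linear.tendsto[OF bounded_linear_Tri(1)]
        bounded_linear.tendsto[OF bounded_linear_Tri(2)]
        bounded_linear.tendsto[OF bounded_linear_Tri(3)] lims)
  then show "convergent X"
    by (auto simp: convergent_def plus_tri_def)
qed

definition tri_scale ::
  "('k \<Rightarrow> 'a \<Rightarrow> 'a) \<Rightarrow> ('k \<Rightarrow> 'm \<Rightarrow> 'm) \<Rightarrow> ('k \<Rightarrow> 'b \<Rightarrow> 'b) \<Rightarrow>
   'k \<Rightarrow> ('a, 'm, 'b) tri \<Rightarrow> ('a, 'm, 'b) tri"
  where "tri_scale scaleA scaleM scaleB c x =
    Tri (scaleA c (ent11 x)) (scaleM c (ent12 x)) (scaleB c (ent22 x))"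

definition tri_mult ::
  "('a \<Rightarrow> 'a \<Rightarrow> 'a) \<Rightarrow> ('a \<Rightarrow> 'm \<Rightarrow> 'm) \<Rightarrow> ('m \<Rightarrow> 'b \<Rightarrow> 'm::plus) \<Rightarrow> ('b \<Rightarrow> 'b \<Rightarrow> 'b) \<Rightarrow>
   ('a, 'm, 'b) tri \<Rightarrow> ('a, 'm, 'b) tri \<Rightarrow> ('a, 'm, 'b) tri"
  where "tri_mult multA lact ract multB x y =
    Tri (multA (ent11 x) (ent11 y))
        (lact (ent11 x) (ent12 y) + ract (ent12 x) (ent22 y))
        (multB (ent22 x) (ent22 y))"

definition dsum :: "'a \<Rightarrow> 'b \<Rightarrow> ('a, 'm::zero, 'b) tri"  (infix \<open>\<oplus>\<^sub>d\<close> 65)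
  where "a \<oplus>\<^sub>d b = Tri a 0 b"

text \<open>
  Restrictions of a map on the triangular algebra to its diagonal corners, read back along
  \<open>a \<mapsto> a \<oplus>\<^sub>d 0\<close> and \<open>b \<mapsto> 0 \<oplus>\<^sub>d b\<close>; see \<open>corner_restrictions\<close> below for the
  invariance of the corners.
\<close>

definition restrict11 ::
  "(('a, 'm::zero, 'b::zero) tri \<Rightarrow> ('a, 'm, 'b) tri) \<Rightarrow> 'a \<Rightarrow> 'a"
  where "restrict11 \<phi> a = ent11 (\<phi> (a \<oplus>\<^sub>d 0))"

definition restrict22 ::
  "(('a::zero, 'm::zero, 'b) tri \<Rightarrow> ('a, 'm, 'b) tri) \<Rightarrow> 'b \<Rightarrow> 'b"
  where "restrict22 \<phi> b = ent22 (\<phi> (0 \<oplus>\<^sub>d b))"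

context unital_banach_bimodule
begin

abbreviation "scaleT \<equiv> tri_scale scaleA scaleM scaleB"
abbreviation "multT \<equiv> tri_mult multA lact ract multB"

lemma lact_0: "lact 0 m = 0" "lact a 0 = 0"
  using lact_add_left[of 0 0 m] lact_add_right[of a 0 0] by simp_all

lemma ract_0: "ract 0 b = 0" "ract m 0 = 0"
  using ract_add_left[of 0 0 b] ract_add_right[of m 0 0] by simp_all

lemma mult_0: "multA 0 a = 0" "multA a 0 = 0" "multB 0 b = 0" "multB b 0 = 0"
  using A.mult_add_left[of 0 0 a] A.mult_add_right[of a 0 0]
    B.mult_add_left[of 0 0 b] B.mult_add_right[of b 0 0] by simp_all

lemma unital_banach_algebra_tri: "unital_banach_algebra scaleT multT (unitA \<oplus>\<^sub>d unitB)"
proof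
  fix x y :: "('a, 'm, 'b) tri"
  obtain a m b where x: "x = Tri a m b" by (cases x)
  obtain a' m' b' where y: "y = Tri a' m' b'" by (cases y)
  have "norm (multT x y) \<le> norm a * norm a' + (norm a * norm m' + norm m * norm b') + norm b * norm b'"
    unfolding tri_mult_def norm_tri_def x y tri.sel
    by (intro add_mono A.norm_mult_le B.norm_mult_le
        order_trans[OF norm_triangle_ineq add_mono[OF norm_lact_le norm_ract_le]])
  also have "\<dots> \<le> norm x * norm y"
    by (simp add: norm_tri_def x y algebra_simps)
  finally show "norm (multT x y) \<le> norm x * norm y" .
qed (auto intro!: tri.expand simp: tri_scale_def tri_mult_def dsum_def norm_tri_def algebra_simps
    A.scale_right_distrib A.scale_left_distrib B.scale_right_distrib B.scale_left_distrib
    M.scale_right_distrib M.scale_left_distrib A.scale_of_real B.scale_of_real M.scale_of_real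
    A.norm_scale B.norm_scale M.norm_scale A.mult_assoc B.mult_assoc
    A.mult_add_left A.mult_add_right B.mult_add_left B.mult_add_right
    A.mult_scale_left A.mult_scale_right B.mult_scale_left B.mult_scale_right
    lact_add_left lact_add_right lact_scale_left lact_scale_right
    ract_add_left ract_add_right ract_scale_left ract_scale_right lact_mult ract_mult lact_ract
    A.unit_left A.unit_right B.unit_left B.unit_right lact_unit ract_unit lact_0 ract_0)

lemma corner_restrictions:
  assumes "continuous_alg_hom scaleT multT \<phi>"
    and e: "\<phi> (unitA \<oplus>\<^sub>d 0) = unitA \<oplus>\<^sub>d 0" and f: "\<phi> (0 \<oplus>\<^sub>d unitB) = 0 \<oplus>\<^sub>d unitB"
  shows "\<phi> (a \<oplus>\<^sub>d 0) = restrict11 \<phi> a \<oplus>\<^sub>d 0" and "\<phi> (0 \<oplus>\<^sub>d b) = 0 \<oplus>\<^sub>d restrict22 \<phi> b"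
proof -
  have hom: "\<phi> (multT x y) = multT (\<phi> x) (\<phi> y)" for x y
    using assms(1) by (simp add: continuous_alg_hom_def)
  have "a \<oplus>\<^sub>d 0 = multT (multT (unitA \<oplus>\<^sub>d 0) (a \<oplus>\<^sub>d 0)) (unitA \<oplus>\<^sub>d 0)"
    by (simp add: tri_mult_def dsum_def A.unit_left A.unit_right mult_0 lact_0 ract_0)
  then have "\<phi> (a \<oplus>\<^sub>d 0) = multT (multT (unitA \<oplus>\<^sub>d 0) (\<phi> (a \<oplus>\<^sub>d 0))) (unitA \<oplus>\<^sub>d 0)"
    by (metis hom e)
  then show "\<phi> (a \<oplus>\<^sub>d 0) = restrict11 \<phi> a \<oplus>\<^sub>d 0"
    by (simp add: restrict11_def tri_mult_def dsum_def A.unit_left A.unit_right mult_0 lact_0 ract_0)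
  have "0 \<oplus>\<^sub>d b = multT (multT (0 \<oplus>\<^sub>d unitB) (0 \<oplus>\<^sub>d b)) (0 \<oplus>\<^sub>d unitB)"
    by (simp add: tri_mult_def dsum_def B.unit_left B.unit_right mult_0 lact_0 ract_0)
  then have "\<phi> (0 \<oplus>\<^sub>d b) = multT (multT (0 \<oplus>\<^sub>d unitB) (\<phi> (0 \<oplus>\<^sub>d b))) (0 \<oplus>\<^sub>d unitB)"
    by (metis hom f)
  then show "\<phi> (0 \<oplus>\<^sub>d b) = 0 \<oplus>\<^sub>d restrict22 \<phi> b"
    by (simp add: restrict22_def tri_mult_def dsum_def B.unit_left B.unit_right mult_0 lact_0 ract_0)
qed

end

end

theory Submission
  imports Defs
begin

text \<open>
  A continuous homomorphism \<open>\<phi>\<close> between two twisted algebras that intertwines the twisting maps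
  turns a derivation \<open>d\<close> into \<open>\<phi>\<^sup>* \<circ> d \<circ> \<phi>\<close>, and turns the inner derivation of \<open>x\<close> into the
  inner derivation of \<open>\<phi>\<^sup>* x\<close>. Because \<open>\<sigma>\<close> and \<open>\<tau>\<close> fix the two diagonal idempotents
  \<open>p = unitA \<oplus>\<^sub>d 0\<close> and \<open>q = 0 \<oplus>\<^sub>d unitB\<close>, they respect the upper triangular shape. So this applies
  both to the inclusion \<open>\<iota>\<close> of a diagonal corner into the triangular algebra and to the
  projection \<open>\<pi>\<close> onto that corner, the latter being multiplicative precisely because the lower left
  entry vanishes.

  If the triangular algebra is weakly amenable, then so is a corner: a derivation \<open>d\<close> of
  the corner is recovered as \<open>d = \<iota>\<^sup>* \<circ> (\<pi>\<^sup>* \<circ> d \<circ> \<pi>) \<circ> \<iota>\<close>, and the map in parentheses is inner.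

  Conversely, let \<open>D\<close> be a derivation of the triangular algebra. Subtracting an inner
  derivation makes \<open>D p = 0\<close> (\<open>derivation_normalise\<close>), and then also \<open>D q = 0\<close>. Now \<open>D\<close> respects Peirce
  corners: \<open>D (e x f) = e \<cdot> D x \<cdot> f\<close> for \<open>e, f \<in> {p, q}\<close>, which is the functional
  \<open>s \<mapsto> D x (f s e)\<close>. On the off-diagonal part, \<open>e = p\<close> and \<open>f = q\<close>, this is zero since
  \<open>q s p = 0\<close>: the module contributes nothing. What remains is the sum of the derivations induced from
  the two corners (\<open>derivation_split\<close>), which are inner by assumption.
\<close>

section \<open>Twisted derivations into the dual\<close>

lemma blinfun_eq_iff_apply: "f = g \<longleftrightarrow> (\<forall>s. blinfun_apply f s = blinfun_apply g s)"
  by (auto intro: blinfun_eqI)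

context banach_algebra
begin

abbreviation dual_derivation :: "('c \<Rightarrow> 'c) \<Rightarrow> ('c \<Rightarrow> 'c) \<Rightarrow> ('c \<Rightarrow> ('c \<Rightarrow>\<^sub>L 'k)) \<Rightarrow> bool"
  where "dual_derivation \<equiv>
    twisted_derivation smul mul (dual smul) dual_scale (dual_lact mul) (dual_ract mul)"

abbreviation dual_inner :: "('c \<Rightarrow> 'c) \<Rightarrow> ('c \<Rightarrow> 'c) \<Rightarrow> ('c \<Rightarrow> ('c \<Rightarrow>\<^sub>L 'k)) \<Rightarrow> bool"
  where "dual_inner \<equiv> twisted_inner (dual smul) (dual_lact mul) (dual_ract mul)"

lemma dual_derivation_iff:
  "dual_derivation \<sigma> \<tau> D \<longleftrightarrow>
    (\<forall>a. D a \<in> dual smul) \<and> (\<forall>a b. D (a + b) = D a + D b) \<and>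
    (\<forall>c a. D (smul c a) = dual_scale c (D a)) \<and>
    (\<forall>a b s. D (mul a b) s = D a (mul (\<sigma> b) s) + D b (mul s (\<tau> a)))"
proof -
  have "(\<forall>a b. D (mul a b) = dual_ract mul (D a) (\<sigma> b) + dual_lact mul (\<tau> a) (D b)) \<longleftrightarrow>
    (\<forall>a b s. D (mul a b) s = D a (mul (\<sigma> b) s) + D b (mul s (\<tau> a)))"
    by (auto simp: blinfun_eq_iff_apply blinfun.add_left dual_ract_apply dual_lact_apply)
  moreover have "Vector_Spaces.linear smul dual_scale D \<longleftrightarrow>
    (\<forall>a b. D (a + b) = D a + D b) \<and> (\<forall>c a. D (smul c a) = dual_scale c (D a))"
    using vector_space_axioms vector_space_dual_scale
    by (auto simp: Vector_Spaces.linear_iff)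
  ultimately show ?thesis
    unfolding twisted_derivation_def by auto
qed

lemma dual_inner_iff:
  "dual_inner \<sigma> \<tau> D \<longleftrightarrow>
    (\<exists>x\<in>dual smul. \<forall>a s. D a s = x (mul s (\<tau> a)) - x (mul (\<sigma> a) s))"
  unfolding twisted_inner_def
  by (simp add: blinfun_eq_iff_apply blinfun.diff_left dual_ract_apply dual_lact_apply)

lemma dual_diff: "f \<in> dual smul \<Longrightarrow> g \<in> dual smul \<Longrightarrow> f - g \<in> dual smul"
  and dual_add: "f \<in> dual smul \<Longrightarrow> g \<in> dual smul \<Longrightarrow> f + g \<in> dual smul"
  by (simp_all add: dual_def blinfun.diff_left blinfun.add_left algebra_simps)

lemma dual_derivation_diff:
  assumes "dual_derivation \<sigma> \<tau> D" "dual_derivation \<sigma> \<tau> D'"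
  shows "dual_derivation \<sigma> \<tau> (\<lambda>a. D a - D' a)"
  using assms unfolding dual_derivation_iff
  by (auto intro!: dual_diff blinfun_eqI simp: dual_scale_apply blinfun.diff_left blinfun.add_left algebra_simps)

lemma dual_inner_add:
  assumes "dual_inner \<sigma> \<tau> D" "dual_inner \<sigma> \<tau> D'"
  shows "dual_inner \<sigma> \<tau> (\<lambda>a. D a + D' a)"
proof -
  obtain x y where "x \<in> dual smul" "\<forall>a s. D a s = x (mul s (\<tau> a)) - x (mul (\<sigma> a) s)"
    "y \<in> dual smul" "\<forall>a s. D' a s = y (mul s (\<tau> a)) - y (mul (\<sigma> a) s)"
    using assms unfolding dual_inner_iff by blast
  then show ?thesis
    unfolding dual_inner_iff
    by (intro bexI[of _ "x + y"]) (simp_all add: dual_add blinfun.add_left)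
qed

lemma bounded_linear_dual_lact:
  fixes f :: "'c \<Rightarrow>\<^sub>L 'k"
  shows "bounded_linear (\<lambda>c. dual_lact mul c f)"
proof (rule bounded_linear_intro[where K = "norm f"])
  show "norm (dual_lact mul c f) \<le> norm c * norm f" for c
  proof (rule norm_blinfun_bound)
    fix s
    have "norm (f (mul s c)) \<le> norm f * (norm s * norm c)"
      by (rule order_trans[OF norm_blinfun mult_left_mono[OF norm_mult_le]]) simp
    then show "norm (dual_lact mul c f s) \<le> norm c * norm f * norm s"
      by (simp add: dual_lact_apply mult_ac)
  qed simp
qed (auto intro!: blinfun_eqI simp: dual_lact_apply mult_add_right blinfun.add_left
    blinfun.add_right blinfun.scaleR_left blinfun.scaleR_right
    bounded_bilinear.scaleR_right[OF bounded_bilinear_mult])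

lemma bounded_linear_dual_ract:
  fixes f :: "'c \<Rightarrow>\<^sub>L 'k"
  shows "bounded_linear (\<lambda>c. dual_ract mul f c)"
proof (rule bounded_linear_intro[where K = "norm f"])
  show "norm (dual_ract mul f c) \<le> norm c * norm f" for c
  proof (rule norm_blinfun_bound)
    fix s
    have "norm (f (mul c s)) \<le> norm f * (norm c * norm s)"
      by (rule order_trans[OF norm_blinfun mult_left_mono[OF norm_mult_le]]) simp
    then show "norm (dual_ract mul f c s) \<le> norm c * norm f * norm s"
      by (simp add: dual_ract_apply mult_ac)
  qed simp
qed (auto intro!: blinfun_eqI simp: dual_ract_apply mult_add_left blinfun.add_left
    blinfun.add_right blinfun.scaleR_left blinfun.scaleR_right
    bounded_bilinear.scaleR_left[OF bounded_bilinear_mult])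

lemma inner_derivation:
  fixes x :: "'c \<Rightarrow>\<^sub>L 'k"
  assumes \<sigma>: "continuous_alg_hom smul mul \<sigma>" and \<tau>: "continuous_alg_hom smul mul \<tau>"
    and x: "x \<in> dual smul"
  shows "dual_derivation \<sigma> \<tau> (\<lambda>a. dual_lact mul (\<tau> a) x - dual_ract mul x (\<sigma> a))" (is "?der")
    and "continuous_on UNIV (\<lambda>a. dual_lact mul (\<tau> a) x - dual_ract mul x (\<sigma> a))" (is "?cont")
    and "dual_inner \<sigma> \<tau> (\<lambda>a. dual_lact mul (\<tau> a) x - dual_ract mul x (\<sigma> a))" (is "?inner")
proof -
  have xs: "x (smul c s) = c * x s" for c s
    using x by (simp add: dual_def)
  have hom: "\<phi> (a + b) = \<phi> a + \<phi> b" "\<phi> (smul c a) = smul c (\<phi> a)" "\<phi> (mul a b) = mul (\<phi> a) (\<phi> b)"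
    if "continuous_alg_hom smul mul \<phi>" for \<phi> a b c
    using that by (auto simp: continuous_alg_hom_def Vector_Spaces.linear_iff)
  show ?der
    unfolding dual_derivation_iff
    by (auto intro!: blinfun_eqI dual_diff dual_lact_in_dual dual_ract_in_dual x
        simp: hom[OF \<sigma>] hom[OF \<tau>] dual_lact_apply dual_ract_apply dual_scale_apply
          blinfun.add_left blinfun.diff_left blinfun.add_right mult_add_left mult_add_right
          mult_scale_left mult_scale_right xs mult_assoc algebra_simps)
  have "continuous_on UNIV \<sigma>" "continuous_on UNIV \<tau>"
    using \<sigma> \<tau> by (simp_all add: continuous_alg_hom_def)
  then show ?cont
    by (intro continuous_on_diff bounded_linear.continuous_on[OF bounded_linear_dual_lact]
        bounded_linear.continuous_on[OF bounded_linear_dual_ract])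
  show ?inner
    using x by (auto simp: twisted_inner_def)
qed

text \<open>
  From \<open>e\<^sup>2 = e\<close> and \<open>\<sigma> e = \<tau> e = e\<close> one gets \<open>D e = D e \<cdot> e + e \<cdot> D e\<close>; multiplying by \<open>e\<close> on both
  sides yields \<open>e \<cdot> D e \<cdot> e = 0\<close>. These two identities show that the inner derivation of \<open>x = e \<cdot> D e - D e \<cdot> e\<close> agrees with \<open>D\<close> at \<open>e\<close>.
\<close>

lemma derivation_normalise:
  assumes \<sigma>: "continuous_alg_hom smul mul \<sigma>" and \<tau>: "continuous_alg_hom smul mul \<tau>"
    and D: "dual_derivation \<sigma> \<tau> D" "continuous_on UNIV D"
    and e: "mul e e = e" "\<sigma> e = e" "\<tau> e = e"
  obtains I D' where "dual_inner \<sigma> \<tau> I" "dual_derivation \<sigma> \<tau> D'" "continuous_on UNIV D'"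
    "D' e = 0" "D = (\<lambda>a. I a + D' a)"
proof -
  define x where "x = dual_lact mul e (D e) - dual_ract mul (D e) e"
  define I where "I = (\<lambda>a. dual_lact mul (\<tau> a) x - dual_ract mul x (\<sigma> a))"
  have x: "x \<in> dual smul"
    using D(1) unfolding x_def dual_derivation_iff
    by (auto intro: dual_diff dual_lact_in_dual dual_ract_in_dual)
  note I = inner_derivation[OF \<sigma> \<tau> x, folded I_def]
  have De: "D e s = D e (mul e s) + D e (mul s e)" for s
    using D(1) e unfolding dual_derivation_iff by metis
  have ee: "mul e (mul e s) = mul e s" "mul (mul s e) e = mul s e" for s
    by (simp_all add: mult_assoc[symmetric] e) (simp add: mult_assoc e)
  have eDe: "D e (mul (mul e s) e) = 0" for s
    using De[of "mul (mul e s) e"] by (simp add: ee mult_assoc[symmetric])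
      (simp add: mult_assoc e)
  have "I e = D e"
  proof (rule blinfun_eqI)
    fix s
    have ese: "mul e (mul s e) = mul (mul e s) e"
      by (simp add: mult_assoc)
    have "I e s = D e (mul s e) + D e (mul e s)"
      by (simp add: I_def x_def e(2,3) dual_lact_apply dual_ract_apply blinfun.diff_left ee ese eDe)
    then show "I e s = D e s"
      using De[of s] by simp
  qed
  then show ?thesis
    by (intro that[of I "\<lambda>a. D a - I a"] I dual_derivation_diff D continuous_on_diff) auto
qed

lemma derivation_unit_eq_0:
  assumes D: "dual_derivation \<sigma> \<tau> D" and u: "\<And>s. mul u s = s" "\<And>s. mul s u = s" "\<sigma> u = u" "\<tau> u = u"
  shows "D u = 0"
proof (rule blinfun_eqI)
  fix s
  have "D (mul u u) s = D u (mul (\<sigma> u) s) + D u (mul s (\<tau> u))"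
    using D unfolding dual_derivation_iff by blast
  then show "D u s = blinfun_apply 0 s"
    by (simp add: u)
qed

text \<open>
  By the Leibniz rule an element that is annihilated by \<open>D\<close> and fixed by the twisting map can be pulled
  out; \<open>f\<close> and \<open>e\<close> change sides because the dual actions are \<open>(e \<cdot> g \<cdot> f)(s) = g (f s e)\<close>.
\<close>

lemma derivation_peirce:
  assumes D: "dual_derivation \<sigma> \<tau> D" and "D e = 0" "D f = 0" "\<tau> e = e" "\<sigma> f = f"
  shows "D (mul e (mul x f)) s = D x (mul f (mul s e))"
proof -
  have leibniz: "D (mul a b) s = D a (mul (\<sigma> b) s) + D b (mul s (\<tau> a))" for a b s
    using D unfolding dual_derivation_iff by blast
  show ?thesis
    by (simp add: leibniz assms)
qed

end

section \<open>Pulling derivations back along homomorphisms\<close>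

text \<open>
  The inclusion of a diagonal corner and the projection onto it are both of this kind; transport
  in the two directions is what compares derivations of the corner with those of the triangular
  algebra.
\<close>

locale twisted_hom =
  C: banach_algebra scaleC multC +
  T: banach_algebra scaleT multT
  for scaleC :: "'k::real_normed_field \<Rightarrow> 'c::banach \<Rightarrow> 'c" and multC
    and scaleT :: "'k \<Rightarrow> 't::banach \<Rightarrow> 't" and multT +
  fixes \<sigma>\<^sub>C \<tau>\<^sub>C :: "'c \<Rightarrow> 'c" and \<sigma>\<^sub>T \<tau>\<^sub>T :: "'t \<Rightarrow> 't" and \<phi> :: "'c \<Rightarrow>\<^sub>L 't"
  assumes hom_scale: "\<phi> (scaleC c x) = scaleT c (\<phi> x)"
    and hom_mult: "\<phi> (multC x y) = multT (\<phi> x) (\<phi> y)"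
    and intertwine: "\<sigma>\<^sub>T (\<phi> x) = \<phi> (\<sigma>\<^sub>C x)" "\<tau>\<^sub>T (\<phi> x) = \<phi> (\<tau>\<^sub>C x)"
begin

definition pullback :: "('t \<Rightarrow> ('t \<Rightarrow>\<^sub>L 'k)) \<Rightarrow> 'c \<Rightarrow> ('c \<Rightarrow>\<^sub>L 'k)"
  where "pullback D a = D (\<phi> a) o\<^sub>L \<phi>"

lemma pullback_apply: "pullback D a s = D (\<phi> a) (\<phi> s)"
  by (simp add: pullback_def)

lemma dual_comp: "f \<in> dual scaleT \<Longrightarrow> f o\<^sub>L \<phi> \<in> dual scaleC"
  by (simp add: dual_def hom_scale)

lemma pullback_derivation:
  assumes "T.dual_derivation \<sigma>\<^sub>T \<tau>\<^sub>T D"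
  shows "C.dual_derivation \<sigma>\<^sub>C \<tau>\<^sub>C (pullback D)"
  using assms unfolding C.dual_derivation_iff T.dual_derivation_iff
  by (auto intro!: blinfun_eqI simp: pullback_def dual_comp dual_scale_apply hom_scale hom_mult
      intertwine blinfun.add_left blinfun.add_right)

lemma pullback_continuous:
  assumes "continuous_on UNIV D"
  shows "continuous_on UNIV (pullback D)"
proof -
  have "continuous_on UNIV (\<lambda>a. D (\<phi> a))"
    by (rule continuous_on_compose2[OF assms]) (auto intro: continuous_intros)
  then show ?thesis
    unfolding pullback_def
    by (rule bounded_bilinear.continuous_on[OF bounded_bilinear_blinfun_compose])
      (rule continuous_on_const)
qed

lemma pullback_inner:
  assumes "T.dual_inner \<sigma>\<^sub>T \<tau>\<^sub>T D"
  shows "C.dual_inner \<sigma>\<^sub>C \<tau>\<^sub>C (pullback D)"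
proof -
  obtain x where "x \<in> dual scaleT" "\<And>a s. D a s = x (multT s (\<tau>\<^sub>T a)) - x (multT (\<sigma>\<^sub>T a) s)"
    using assms unfolding T.dual_inner_iff by blast
  then show ?thesis
    unfolding C.dual_inner_iff
    by (intro bexI[of _ "x o\<^sub>L \<phi>"]) (auto simp: dual_comp pullback_apply hom_mult intertwine)
qed

end

text \<open>
  A derivation of a retract extends along the projection to a derivation of the whole algebra, and
  restricting this extension gives it back.
\<close>

lemma weakly_amenable_retract:
  assumes incl: "twisted_hom scaleC multC scaleT multT \<sigma>\<^sub>C \<tau>\<^sub>C \<sigma>\<^sub>T \<tau>\<^sub>T \<iota>"
    and proj: "twisted_hom scaleT multT scaleC multC \<sigma>\<^sub>T \<tau>\<^sub>T \<sigma>\<^sub>C \<tau>\<^sub>C \<pi>"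
    and retract: "\<And>x. blinfun_apply \<pi> (blinfun_apply \<iota> x) = x"
    and T: "weakly_amenable scaleT multT \<sigma>\<^sub>T \<tau>\<^sub>T"
  shows "weakly_amenable scaleC multC \<sigma>\<^sub>C \<tau>\<^sub>C"
proof -
  interpret incl: twisted_hom scaleC multC scaleT multT \<sigma>\<^sub>C \<tau>\<^sub>C \<sigma>\<^sub>T \<tau>\<^sub>T \<iota> by fact
  interpret proj: twisted_hom scaleT multT scaleC multC \<sigma>\<^sub>T \<tau>\<^sub>T \<sigma>\<^sub>C \<tau>\<^sub>C \<pi> by fact
  show ?thesis
    unfolding weakly_amenable_def
  proof (intro allI impI, elim conjE)
    fix d :: "'b \<Rightarrow> ('b \<Rightarrow>\<^sub>L 'a)"
    assume "incl.C.dual_derivation \<sigma>\<^sub>C \<tau>\<^sub>C d" "continuous_on UNIV d"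
    then have "incl.T.dual_inner \<sigma>\<^sub>T \<tau>\<^sub>T (proj.pullback d)"
      using T proj.pullback_derivation proj.pullback_continuous
      unfolding weakly_amenable_def by blast
    then have "incl.C.dual_inner \<sigma>\<^sub>C \<tau>\<^sub>C (incl.pullback (proj.pullback d))"
      by (rule incl.pullback_inner)
    also have "incl.pullback (proj.pullback d) = d"
      by (auto intro!: ext blinfun_eqI simp: incl.pullback_apply proj.pullback_apply retract)
    finally show "incl.C.dual_inner \<sigma>\<^sub>C \<tau>\<^sub>C d" .
  qed
qed

section \<open>The triangular algebra and its diagonal corners\<close>

locale twisted_triangular =
  unital_banach_bimodule scaleA multA unitA scaleB multB unitB scaleM lact ract
  for scaleA :: "'k::real_normed_field \<Rightarrow> 'a::banach \<Rightarrow> 'a" and multA unitA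
    and scaleB :: "'k \<Rightarrow> 'b::banach \<Rightarrow> 'b" and multB unitB
    and scaleM :: "'k \<Rightarrow> 'm::banach \<Rightarrow> 'm" and lact ract +
  fixes \<sigma> \<tau> :: "('a, 'm, 'b) tri \<Rightarrow> ('a, 'm, 'b) tri"
  assumes hom: "continuous_alg_hom scaleT multT \<sigma>" "continuous_alg_hom scaleT multT \<tau>"
    and fix_p: "\<sigma> (unitA \<oplus>\<^sub>d 0) = unitA \<oplus>\<^sub>d 0" "\<tau> (unitA \<oplus>\<^sub>d 0) = unitA \<oplus>\<^sub>d 0"
    and fix_q: "\<sigma> (0 \<oplus>\<^sub>d unitB) = 0 \<oplus>\<^sub>d unitB" "\<tau> (0 \<oplus>\<^sub>d unitB) = 0 \<oplus>\<^sub>d unitB"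
begin

sublocale T: unital_banach_algebra scaleT multT "unitA \<oplus>\<^sub>d unitB"
  by (rule unital_banach_algebra_tri)

lemmas tri_simps = tri_mult_def dsum_def mult_0 lact_0 ract_0
  A.unit_left A.unit_right B.unit_left B.unit_right lact_unit ract_unit

lemma tri_decompose: "x = (ent11 x \<oplus>\<^sub>d 0) + Tri 0 (ent12 x) 0 + (0 \<oplus>\<^sub>d ent22 x)"
  by (cases x) (simp add: dsum_def plus_tri_def)

lemma tri_mult_corner:
  "ent11 (multT (unitA \<oplus>\<^sub>d 0) (multT x (0 \<oplus>\<^sub>d unitB))) = 0"
  "ent22 (multT (unitA \<oplus>\<^sub>d 0) (multT x (0 \<oplus>\<^sub>d unitB))) = 0"
  by (simp_all add: tri_simps)

text \<open>
  A homomorphism fixing \<open>p\<close> and \<open>q\<close> keeps the off-diagonal part \<open>p T q\<close> in place, hence does not leak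
  it into the diagonal.
\<close>

lemma diagonal_of_hom:
  assumes \<phi>: "continuous_alg_hom scaleT multT \<phi>"
    and p: "\<phi> (unitA \<oplus>\<^sub>d 0) = unitA \<oplus>\<^sub>d 0" and q: "\<phi> (0 \<oplus>\<^sub>d unitB) = 0 \<oplus>\<^sub>d unitB"
  shows "ent11 (\<phi> x) = restrict11 \<phi> (ent11 x)" and "ent22 (\<phi> x) = restrict22 \<phi> (ent22 x)"
proof -
  have add: "\<phi> (y + z) = \<phi> y + \<phi> z" and mult: "\<phi> (multT y z) = multT (\<phi> y) (\<phi> z)" for y z
    using \<phi> by (auto simp: continuous_alg_hom_def Vector_Spaces.linear_iff)
  let ?m = "Tri 0 (ent12 x) 0"
  have "?m = multT (unitA \<oplus>\<^sub>d 0) (multT ?m (0 \<oplus>\<^sub>d unitB))"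
    by (simp add: tri_simps)
  then have "\<phi> ?m = multT (unitA \<oplus>\<^sub>d 0) (multT (\<phi> ?m) (0 \<oplus>\<^sub>d unitB))"
    by (metis mult p q)
  then have m: "ent11 (\<phi> ?m) = 0" "ent22 (\<phi> ?m) = 0"
    by (metis (no_types) tri_mult_corner)+
  have "\<phi> x = \<phi> (ent11 x \<oplus>\<^sub>d 0) + \<phi> ?m + \<phi> (0 \<oplus>\<^sub>d ent22 x)"
    by (metis add tri_decompose)
  also have "\<dots> = (restrict11 \<phi> (ent11 x) \<oplus>\<^sub>d 0) + \<phi> ?m + (0 \<oplus>\<^sub>d restrict22 \<phi> (ent22 x))"
    by (simp only: corner_restrictions[OF \<phi> p q])
  finally show "ent11 (\<phi> x) = restrict11 \<phi> (ent11 x)" "ent22 (\<phi> x) = restrict22 \<phi> (ent22 x)"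
    by (simp_all add: m dsum_def)
qed

definition inclA :: "'a \<Rightarrow>\<^sub>L ('a, 'm, 'b) tri" where "inclA = Blinfun (\<lambda>a. a \<oplus>\<^sub>d 0)"
definition inclB :: "'b \<Rightarrow>\<^sub>L ('a, 'm, 'b) tri" where "inclB = Blinfun (\<lambda>b. 0 \<oplus>\<^sub>d b)"
definition projA :: "('a, 'm, 'b) tri \<Rightarrow>\<^sub>L 'a" where "projA = Blinfun ent11"
definition projB :: "('a, 'm, 'b) tri \<Rightarrow>\<^sub>L 'b" where "projB = Blinfun ent22"

lemma corner_maps_apply:
  "inclA a = a \<oplus>\<^sub>d 0" "inclB b = 0 \<oplus>\<^sub>d b" "projA x = ent11 x" "projB x = ent22 x"
  by (simp_all add: inclA_def inclB_def projA_def projB_def dsum_def bounded_linear_Blinfun_apply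
      bounded_linear_ent bounded_linear_Tri)

sublocale inclA: twisted_hom scaleA multA scaleT multT "restrict11 \<sigma>" "restrict11 \<tau>" \<sigma> \<tau> inclA
  by unfold_locales
    (simp_all add: corner_maps_apply corner_restrictions[OF hom(1) fix_p(1) fix_q(1)]
      corner_restrictions[OF hom(2) fix_p(2) fix_q(2)], simp_all add: tri_simps tri_scale_def)

sublocale inclB: twisted_hom scaleB multB scaleT multT "restrict22 \<sigma>" "restrict22 \<tau>" \<sigma> \<tau> inclB
  by unfold_locales
    (simp_all add: corner_maps_apply corner_restrictions[OF hom(1) fix_p(1) fix_q(1)]
      corner_restrictions[OF hom(2) fix_p(2) fix_q(2)], simp_all add: tri_simps tri_scale_def)

sublocale projA: twisted_hom scaleT multT scaleA multA \<sigma> \<tau> "restrict11 \<sigma>" "restrict11 \<tau>" projA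
  by unfold_locales
    (simp_all add: corner_maps_apply diagonal_of_hom[OF hom(1) fix_p(1) fix_q(1)]
      diagonal_of_hom[OF hom(2) fix_p(2) fix_q(2)] tri_mult_def tri_scale_def)

sublocale projB: twisted_hom scaleT multT scaleB multB \<sigma> \<tau> "restrict22 \<sigma>" "restrict22 \<tau>" projB
  by unfold_locales
    (simp_all add: corner_maps_apply diagonal_of_hom[OF hom(1) fix_p(1) fix_q(1)]
      diagonal_of_hom[OF hom(2) fix_p(2) fix_q(2)] tri_mult_def tri_scale_def)

text \<open>
  Only the diagonal survives: on the part \<open>p x q\<close> the derivation is \<open>s \<mapsto> D x (q s p)\<close>, and
  \<open>q s p\<close> is the lower left entry of \<open>s\<close>.
\<close>

lemma derivation_split:
  assumes D: "T.dual_derivation \<sigma> \<tau> D" and p: "D (unitA \<oplus>\<^sub>d 0) = 0"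
  shows "D = (\<lambda>x. projA.pullback (inclA.pullback D) x + projB.pullback (inclB.pullback D) x)"
proof (intro ext blinfun_eqI)
  fix x s :: "('a, 'm, 'b) tri"
  let ?p = "unitA \<oplus>\<^sub>d 0 :: ('a, 'm, 'b) tri" and ?q = "0 \<oplus>\<^sub>d unitB :: ('a, 'm, 'b) tri"
  have add: "D (y + z) = D y + D z" for y z
    using D unfolding T.dual_derivation_iff by blast
  have one: "unitA \<oplus>\<^sub>d unitB = ?p + ?q"
    by (simp add: dsum_def plus_tri_def)
  have hom_add: "\<sigma> (y + z) = \<sigma> y + \<sigma> z" "\<tau> (y + z) = \<tau> y + \<tau> z" for y z
    using hom by (auto simp: continuous_alg_hom_def Vector_Spaces.linear_iff)
  have "D (?p + ?q) = 0"
    by (rule T.derivation_unit_eq_0[OF D])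
      (simp_all add: one[symmetric] T.unit_left T.unit_right, simp_all add: one hom_add fix_p fix_q)
  then have q: "D ?q = 0"
    by (simp add: add p)
  note peirce = T.derivation_peirce[OF D, of _ _ _ s]
  have a: "D (ent11 x \<oplus>\<^sub>d 0) s = D (ent11 x \<oplus>\<^sub>d 0) (ent11 s \<oplus>\<^sub>d 0)"
    using peirce[OF p p fix_p(2) fix_p(1), of "ent11 x \<oplus>\<^sub>d 0"] by (simp add: tri_simps)
  have b: "D (0 \<oplus>\<^sub>d ent22 x) s = D (0 \<oplus>\<^sub>d ent22 x) (0 \<oplus>\<^sub>d ent22 s)"
    using peirce[OF q q fix_q(2) fix_q(1), of "0 \<oplus>\<^sub>d ent22 x"] by (simp add: tri_simps)
  have "Tri 0 0 0 = (0 :: ('a, 'm, 'b) tri)"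
    by (simp add: zero_tri_def)
  then have m: "D (Tri 0 (ent12 x) 0) s = 0"
    using peirce[OF p q fix_p(2) fix_q(1), of "Tri 0 (ent12 x) 0"] by (simp add: tri_simps)
  have "D x s = (D (ent11 x \<oplus>\<^sub>d 0) + D (Tri 0 (ent12 x) 0) + D (0 \<oplus>\<^sub>d ent22 x)) s"
    by (metis add tri_decompose)
  then show "D x s =
      (projA.pullback (inclA.pullback D) x + projB.pullback (inclB.pullback D) x) s"
    by (simp add: blinfun.add_left a b m projA.pullback_apply inclA.pullback_apply
        projB.pullback_apply inclB.pullback_apply corner_maps_apply)
qed

lemma weakly_amenable_of_corners:
  assumes A: "weakly_amenable scaleA multA (restrict11 \<sigma>) (restrict11 \<tau>)"
    and B: "weakly_amenable scaleB multB (restrict22 \<sigma>) (restrict22 \<tau>)"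
  shows "weakly_amenable scaleT multT \<sigma> \<tau>"
  unfolding weakly_amenable_def
proof (intro allI impI, elim conjE)
  fix D :: "('a, 'm, 'b) tri \<Rightarrow> (('a, 'm, 'b) tri \<Rightarrow>\<^sub>L 'k)"
  assume D: "T.dual_derivation \<sigma> \<tau> D" "continuous_on UNIV D"
  have "multT (unitA \<oplus>\<^sub>d 0) (unitA \<oplus>\<^sub>d 0) = unitA \<oplus>\<^sub>d 0"
    by (simp add: tri_simps)
  then obtain I D' where I: "T.dual_inner \<sigma> \<tau> I" and D': "T.dual_derivation \<sigma> \<tau> D'"
    "continuous_on UNIV D'" "D' (unitA \<oplus>\<^sub>d 0) = 0" and D_eq: "D = (\<lambda>x. I x + D' x)"
    using T.derivation_normalise[OF hom D _ fix_p] by blast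
  have "A.dual_inner (restrict11 \<sigma>) (restrict11 \<tau>) (inclA.pullback D')"
    using A inclA.pullback_derivation[OF D'(1)] inclA.pullback_continuous[OF D'(2)]
    unfolding weakly_amenable_def by blast
  moreover have "B.dual_inner (restrict22 \<sigma>) (restrict22 \<tau>) (inclB.pullback D')"
    using B inclB.pullback_derivation[OF D'(1)] inclB.pullback_continuous[OF D'(2)]
    unfolding weakly_amenable_def by blast
  ultimately have "T.dual_inner \<sigma> \<tau> D'"
    by (subst derivation_split[OF D'(1,3)])
      (intro T.dual_inner_add projA.pullback_inner projB.pullback_inner)
  then show "T.dual_inner \<sigma> \<tau> D"
    unfolding D_eq using I by (intro T.dual_inner_add)
qed

lemma corners_weakly_amenable:
  assumes "weakly_amenable scaleT multT \<sigma> \<tau>"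
  shows "weakly_amenable scaleA multA (restrict11 \<sigma>) (restrict11 \<tau>)"
    and "weakly_amenable scaleB multB (restrict22 \<sigma>) (restrict22 \<tau>)"
proof -
  show "weakly_amenable scaleA multA (restrict11 \<sigma>) (restrict11 \<tau>)"
    by (rule weakly_amenable_retract[OF inclA.twisted_hom_axioms projA.twisted_hom_axioms _ assms])
      (simp add: corner_maps_apply dsum_def)
  show "weakly_amenable scaleB multB (restrict22 \<sigma>) (restrict22 \<tau>)"
    by (rule weakly_amenable_retract[OF inclB.twisted_hom_axioms projB.twisted_hom_axioms _ assms])
      (simp add: corner_maps_apply dsum_def)
qed

end

section \<open>Weak amenability of triangular Banach algebras\<close>

theorem corollary3p2:
  fixes scaleA :: "'k::real_normed_field \<Rightarrow> 'a::banach \<Rightarrow> 'a"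
    and scaleB :: "'k \<Rightarrow> 'b::banach \<Rightarrow> 'b"
    and scaleM :: "'k \<Rightarrow> 'm::banach \<Rightarrow> 'm"
    and multA :: "'a \<Rightarrow> 'a \<Rightarrow> 'a" and unitA :: 'a
    and multB :: "'b \<Rightarrow> 'b \<Rightarrow> 'b" and unitB :: 'b
    and lact :: "'a \<Rightarrow> 'm \<Rightarrow> 'm" and ract :: "'m \<Rightarrow> 'b \<Rightarrow> 'm"
    and \<sigma> \<tau> :: "('a, 'm, 'b) tri \<Rightarrow> ('a, 'm, 'b) tri"
  assumes "unital_banach_algebra scaleA multA unitA"
    and "unital_banach_algebra scaleB multB unitB"
    and "unital_banach_bimodule scaleA multA unitA scaleB multB unitB scaleM lact ract"
    and "continuous_alg_hom (tri_scale scaleA scaleM scaleB) (tri_mult multA lact ract multB) \<sigma>"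
    and "continuous_alg_hom (tri_scale scaleA scaleM scaleB) (tri_mult multA lact ract multB) \<tau>"
    and "\<sigma> (unitA \<oplus>\<^sub>d 0) = unitA \<oplus>\<^sub>d 0" and "\<tau> (unitA \<oplus>\<^sub>d 0) = unitA \<oplus>\<^sub>d 0"
    and "\<sigma> (0 \<oplus>\<^sub>d unitB) = 0 \<oplus>\<^sub>d unitB" and "\<tau> (0 \<oplus>\<^sub>d unitB) = 0 \<oplus>\<^sub>d unitB"
  shows "weakly_amenable (tri_scale scaleA scaleM scaleB) (tri_mult multA lact ract multB) \<sigma> \<tau> \<longleftrightarrow>
    weakly_amenable scaleA multA (restrict11 \<sigma>) (restrict11 \<tau>) \<and>
    weakly_amenable scaleB multB (restrict22 \<sigma>) (restrict22 \<tau>)"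
proof -
  interpret twisted_triangular scaleA multA unitA scaleB multB unitB scaleM lact ract \<sigma> \<tau>
    using assms by (intro twisted_triangular.intro twisted_triangular_axioms.intro)
  show ?thesis
    using weakly_amenable_of_corners corners_weakly_amenable by blast
qed

end
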